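(* Let $T$ be a tree of order $n$ and maximum degree $\Delta(T)=k$. Then $\mathrm{rad}(B_{n,k})\leq \mathrm{rad}(T)$, where $B_{n,k}$ denotes any $k$-balanced tree of order $n$.
   Context: All graphs are finite, simple, undirected and connected; $\mathrm{dist}(u,v)$ is the number of edges of a shortest $u$–$v$ path. The eccentricity of a vertex $x$ is $\mathrm{ecc}(x)=\max_{y}\mathrm{dist}(x,y)$ and the radius is $\mathrm{rad}(G)=\min_x \mathrm{ecc}(x)$. A tree $T$ of maximum degree $k$ is called $k$-balanced if there exists a vertex $x$ such that every vertex $z$ with $\mathrm{dist}(z,x)\leq \mathrm{ecc}(x)-2$ satisfies $\deg(z)=k$. The radius of a $k$-balanced tree of order $n$ depends only on $n$ and $k$; $B_{n,k}$ denotes an arbitrary $k$-balanced tree of order $n$. *)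

theory Defs
  imports "Graph_Theory.Graph_Theory"
begin

text \<open>
  Finite simple undirected graphs are the symmetric loop-free digraphs of the locale
  \<^locale>\<open>pair_graph\<close>: each edge is represented by its two opposite arcs.
\<close>

text \<open>
  Under this representation the closed walk a, b, a along a single edge counts as a
  \<^const>\<open>pre_digraph.cycle\<close>, so the library's predicate \<^const>\<open>tree\<close> fails for every
  symmetric digraph with an edge.  The cycles of the undirected graph are exactly the
  cycles of length at least 3.
\<close>

definition acyclic_ugraph :: "'a pair_pre_digraph \<Rightarrow> bool" where
  "acyclic_ugraph G \<longleftrightarrow> \<not> (\<exists>p. pre_digraph.cycle (with_proj G) p \<and> 3 \<le> length p)"

definition tree_ugraph :: "'a pair_pre_digraph \<Rightarrow> bool" where
  "tree_ugraph G \<longleftrightarrow>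
     pair_graph G \<and> Digraph_Component.connected (with_proj G) \<and> acyclic_ugraph G"

text \<open>Each edge at a vertex contributes exactly one outgoing arc.\<close>

definition degree_ugraph :: "'a pair_pre_digraph \<Rightarrow> 'a \<Rightarrow> nat" where
  "degree_ugraph G v = out_degree (with_proj G) v"

definition max_degree_ugraph :: "'a pair_pre_digraph \<Rightarrow> nat" where
  "max_degree_ugraph G = Max (degree_ugraph G ` pverts G)"

text \<open>Meaningful only when some path joins the two vertices, e.g. in connected graphs.\<close>

definition dist_ugraph :: "'a pair_pre_digraph \<Rightarrow> 'a \<Rightarrow> 'a \<Rightarrow> nat" where
  "dist_ugraph G u v = (LEAST l. \<exists>p. pre_digraph.apath (with_proj G) u p v \<and> length p = l)"

definition ecc_ugraph :: "'a pair_pre_digraph \<Rightarrow> 'a \<Rightarrow> nat" where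
  "ecc_ugraph G x = Max (dist_ugraph G x ` pverts G)"

definition rad_ugraph :: "'a pair_pre_digraph \<Rightarrow> nat" where
  "rad_ugraph G = Min (ecc_ugraph G ` pverts G)"

text \<open>
  The bound \<open>dist(z, x) \<le> ecc(x) - 2\<close> is stated additively, since subtraction on
  \<^typ>\<open>nat\<close> is truncated.
\<close>

definition balanced_tree :: "nat \<Rightarrow> 'a pair_pre_digraph \<Rightarrow> bool" where
  "balanced_tree k G \<longleftrightarrow>
     tree_ugraph G \<and> max_degree_ugraph G = k \<and>
     (\<exists>x\<in>pverts G. \<forall>z\<in>pverts G.
        dist_ugraph G z x + 2 \<le> ecc_ugraph G x \<longrightarrow> degree_ugraph G z = k)"

end

theory Submission
  imports Defs
begin

text \<open>
  Root \<open>T\<close> at a vertex of minimum eccentricity \<open>r\<close> and \<open>B\<close> at its balanced centre, of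
  eccentricity \<open>e\<close>. Every vertex other than the root has a neighbour closer to the root, so the
  \<open>i\<close>-th distance level of \<open>T\<close> has at most \<open>k * (k - 1) ^ (i - 1)\<close> vertices for \<open>i > 0\<close>. In \<open>B\<close>
  this is an equality for \<open>0 < i < e\<close>, because in a tree no other neighbour of a vertex fails
  to be farther from the root. Level \<open>e\<close> of \<open>B\<close> is nonempty, so \<open>e > r\<close> would give \<open>B\<close> more
  vertices than \<open>T\<close>.
\<close>

text \<open>The size of level \<open>i\<close> around a vertex of the \<open>k\<close>-regular tree.
  The root has no parent and so gets its own factor \<open>k\<close>.\<close>

definition level_bound :: "nat \<Rightarrow> nat \<Rightarrow> nat" where
  "level_bound k i = (case i of 0 \<Rightarrow> 1 | Suc j \<Rightarrow> k * (k - 1) ^ j)"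

locale pair_connected_graph = pair_graph +
  assumes connected: "Digraph_Component.connected (with_proj G)"
begin

lemma strongly_connected: "Digraph_Component.strongly_connected (with_proj G)"
  using connected sym_arcs by (rule symmetric_connected_imp_strongly_connected[rotated])

lemma verts_nonempty: "pverts G \<noteq> {}"
  using strongly_connected by (auto simp: strongly_connected_def)

section \<open>Distances in connected graphs\<close>

text \<open>\<open>dist_ugraph\<close> minimises over paths only; this extends the bound to walks.
  Reducing a walk to a path introduces no new arcs, and a path repeats no arc, so comparing arc sets
  compares lengths.\<close>

lemma dist_le:
  assumes "awalk u p v"
  shows "dist_ugraph G u v \<le> length p"
proof -
  have path: "apath u (awalk_to_apath p) v"
    using assms by (rule apath_awalk_to_apath)
  then have "distinct (awalk_to_apath p)"
    by (auto simp: apath_def intro: distinct_verts_imp_distinct)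
  then have "length (awalk_to_apath p) = card (set (awalk_to_apath p))"
    by (simp add: distinct_card)
  also have "\<dots> \<le> card (set p)"
    using assms by (intro card_mono awalk_to_apath_subset) auto
  also have "\<dots> \<le> length p" by (rule card_length)
  finally have "length (awalk_to_apath p) \<le> length p" .
  moreover have "dist_ugraph G u v \<le> length (awalk_to_apath p)"
    unfolding dist_ugraph_def using path by (intro Least_le) blast
  ultimately show ?thesis by linarith
qed

lemma shortest_path:
  assumes "u \<in> pverts G" "v \<in> pverts G"
  obtains p where "apath u p v" "length p = dist_ugraph G u v"
proof -
  have "u \<rightarrow>\<^sup>*\<^bsub>with_proj G\<^esub> v"
    using strongly_connected assms by (auto simp: strongly_connected_def)
  then obtain p where "apath u p v" by (auto simp: reachable_apath)
  then have "\<exists>l. \<exists>p. apath u p v \<and> length p = l" by blast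
  from LeastI_ex[OF this] show ?thesis
    using that unfolding dist_ugraph_def by blast
qed

lemma dist_commute:
  assumes "u \<in> pverts G" "v \<in> pverts G"
  shows "dist_ugraph G u v = dist_ugraph G v u"
  unfolding dist_ugraph_def
proof (rule arg_cong[of _ _ Least], rule ext)
  have "length (rev_path p) = length p" for p :: "('a \<times> 'a) list"
    by (induction p) auto
  then show "(\<exists>p. apath u p v \<and> length p = l) = (\<exists>p. apath v p u \<and> length p = l)" for l
    by (metis apath_rev_path)
qed

lemma dist_eq_0_iff:
  assumes "u \<in> pverts G" "v \<in> pverts G"
  shows "dist_ugraph G u v = 0 \<longleftrightarrow> u = v"
proof
  assume "dist_ugraph G u v = 0"
  with shortest_path[OF assms] show "u = v" by (metis length_0_conv apath_Nil_iff)
next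
  assume "u = v"
  with assms dist_le[of u "[]" v] show "dist_ugraph G u v = 0" by (simp add: awalk_Nil_iff)
qed

lemma dist_arc_le:
  assumes "x \<in> pverts G" "(u, v) \<in> parcs G"
  shows "dist_ugraph G x v \<le> Suc (dist_ugraph G x u)"
proof -
  have u: "u \<in> pverts G" using assms(2) by (rule in_arcsD1)
  obtain p where p: "apath x p u" "length p = dist_ugraph G x u"
    using shortest_path[OF assms(1) u] .
  have "awalk u [(u, v)] v" using assms(2) by (auto simp: awalk_simps intro: in_arcsD1 in_arcsD2)
  with p(1) have "awalk x (p @ [(u, v)]) v" by (auto simp: apath_def)
  from dist_le[OF this] p(2) show ?thesis by simp
qed

text \<open>Dropping the last arc of a shortest path leaves a walk that is one arc shorter;
  \<open>dist_arc_le\<close> gives the other inequality.\<close>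

lemma obtain_parent:
  assumes "x \<in> pverts G" "v \<in> pverts G" "v \<noteq> x"
  obtains u where "(u, v) \<in> parcs G" "dist_ugraph G x v = Suc (dist_ugraph G x u)"
proof -
  obtain p where p: "apath x p v" "length p = dist_ugraph G x v"
    using shortest_path[OF assms(1,2)] .
  have "p \<noteq> []"
  proof
    assume "p = []"
    with p(1) assms(3) show False by (simp add: apath_Nil_iff)
  qed
  then obtain q a where pq: "p = q @ [a]" by (metis rev_exhaust)
  obtain u w where a: "a = (u, w)" by (cases a)
  have "awalk x (q @ [(u, w)]) v" using p(1) unfolding pq a by (rule awalkI_apath)
  then have walk: "awalk x q u" and arc: "(u, v) \<in> parcs G"
    by (auto simp: awalk_simps)
  have "Suc (dist_ugraph G x u) \<le> dist_ugraph G x v"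
    using dist_le[OF walk] p(2) unfolding pq by simp
  with dist_arc_le[OF assms(1) arc] show ?thesis
    using that[OF arc] by linarith
qed

section \<open>Levels around a root and their upper bound\<close>

definition nbrs :: "'a \<Rightarrow> 'a set" where
  "nbrs v = {w. (v, w) \<in> parcs G}"

definition children :: "'a \<Rightarrow> 'a \<Rightarrow> 'a set" where
  "children x v = {w \<in> nbrs v. dist_ugraph G x w = Suc (dist_ugraph G x v)}"

definition level :: "'a \<Rightarrow> nat \<Rightarrow> 'a set" where
  "level x i = {v \<in> pverts G. dist_ugraph G x v = i}"

lemma finite_nbrs: "finite (nbrs v)"
  by (rule finite_subset[OF _ pair_finite_verts]) (auto simp: nbrs_def in_arcsD2)

lemma finite_level: "finite (level x i)"
  by (simp add: level_def)

lemma degree_eq_card_nbrs: "degree_ugraph G v = card (nbrs v)"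
proof -
  have "out_arcs (with_proj G) v = Pair v ` nbrs v"
    by (auto simp: out_arcs_def nbrs_def)
  then show ?thesis
    by (simp add: degree_ugraph_def out_degree_def card_image inj_on_def)
qed

lemma card_nbrs_le: "v \<in> pverts G \<Longrightarrow> card (nbrs v) \<le> max_degree_ugraph G"
  unfolding max_degree_ugraph_def degree_eq_card_nbrs[symmetric]
  by (intro Max_ge) auto

lemma level_0: "x \<in> pverts G \<Longrightarrow> level x 0 = {x}"
  by (auto simp: level_def dist_eq_0_iff)

text \<open>Without loops every neighbour of the root is at positive distance, so none is lost to a
  parent.\<close>

lemma children_root:
  assumes "x \<in> pverts G"
  shows "children x x = nbrs x"
proof -
  have "dist_ugraph G x w = Suc (dist_ugraph G x x)" if "(x, w) \<in> parcs G" for w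
  proof -
    have "w \<in> pverts G" "x \<noteq> w" using that no_loops' by (auto dest: in_arcsD2)
    then have "dist_ugraph G x w \<noteq> 0" "dist_ugraph G x x = 0"
      using assms by (simp_all add: dist_eq_0_iff)
    with dist_arc_le[OF assms that] show ?thesis by linarith
  qed
  then show ?thesis by (auto simp: children_def nbrs_def)
qed

lemma level_Suc:
  assumes "x \<in> pverts G"
  shows "level x (Suc i) = (\<Union>v\<in>level x i. children x v)"
proof
  show "level x (Suc i) \<subseteq> (\<Union>v\<in>level x i. children x v)"
  proof
    fix v assume "v \<in> level x (Suc i)"
    then have v: "v \<in> pverts G" "dist_ugraph G x v = Suc i" by (auto simp: level_def)
    moreover have "v \<noteq> x" using v dist_eq_0_iff[OF assms assms] by auto
    ultimately obtain u where "(u, v) \<in> parcs G" "dist_ugraph G x v = Suc (dist_ugraph G x u)"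
      using obtain_parent assms by blast
    with v show "v \<in> (\<Union>v\<in>level x i. children x v)"
      by (auto simp: level_def children_def nbrs_def dest: in_arcsD1)
  qed
qed (auto simp: level_def children_def nbrs_def dest: in_arcsD2)

text \<open>The parent is a neighbour lying one level nearer the root, hence not a child.\<close>

lemma card_children_le:
  assumes "x \<in> pverts G" "v \<in> pverts G" "v \<noteq> x"
  shows "card (children x v) \<le> card (nbrs v) - 1"
proof -
  obtain u where u: "(u, v) \<in> parcs G" "dist_ugraph G x v = Suc (dist_ugraph G x u)"
    using obtain_parent[OF assms] .
  then have "u \<in> nbrs v" by (auto simp: nbrs_def arcs_symmetric)
  moreover have "children x v \<subseteq> nbrs v - {u}" using u by (auto simp: children_def)
  ultimately show ?thesis
    using card_mono[of "nbrs v - {u}" "children x v"] finite_nbrs by simp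
qed


lemma card_level_le:
  assumes "x \<in> pverts G"
  shows "card (level x i) \<le> level_bound (max_degree_ugraph G) i"
proof (induction i)
  case 0
  then show ?case using assms by (simp add: level_0 level_bound_def)
next
  case (Suc i)
  let ?k = "max_degree_ugraph G"
  show ?case
  proof (cases i)
    case 0
    then show ?thesis
      using assms card_nbrs_le by (simp add: level_Suc level_0 children_root level_bound_def)
  next
    case (Suc j)
    \<comment> \<open>Without acyclicity a vertex can be a child of several vertices, so the union
      bound is only an inequality.\<close>
    have "card (level x (Suc i)) \<le> (\<Sum>v\<in>level x i. card (children x v))"
      unfolding level_Suc[OF assms] by (intro card_UN_le finite_level)
    also have "\<dots> \<le> (\<Sum>v\<in>level x i. ?k - 1)"
    proof (rule sum_mono)
      fix v assume "v \<in> level x i"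
      then have "v \<in> pverts G" "v \<noteq> x"
        using dist_eq_0_iff[OF assms assms] Suc by (auto simp: level_def)
      then show "card (children x v) \<le> ?k - 1"
        using card_children_le[OF assms] card_nbrs_le by (meson diff_le_mono order_trans)
    qed
    also have "\<dots> \<le> level_bound ?k i * (?k - 1)" using Suc.IH by simp
    also have "\<dots> = level_bound ?k (Suc i)" using Suc by (simp add: level_bound_def)
    finally show ?thesis .
  qed
qed

section \<open>Eccentricity and radius\<close>

lemma dist_le_ecc: "v \<in> pverts G \<Longrightarrow> dist_ugraph G x v \<le> ecc_ugraph G x"
  unfolding ecc_ugraph_def by (intro Max_ge) auto

lemma level_ecc_nonempty: "level x (ecc_ugraph G x) \<noteq> {}"
proof -
  have "ecc_ugraph G x \<in> dist_ugraph G x ` pverts G"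
    unfolding ecc_ugraph_def using verts_nonempty by (intro Max_in) auto
  then show ?thesis by (auto simp: level_def)
qed

lemma card_verts_eq_sum_level:
  "card (pverts G) = (\<Sum>i\<le>ecc_ugraph G x. card (level x i))"
proof -
  have "pverts G = (\<Union>i\<in>{..ecc_ugraph G x}. level x i)"
    using dist_le_ecc by (auto simp: level_def)
  then show ?thesis
    using card_UN_disjoint[of "{..ecc_ugraph G x}" "level x"] finite_level
    by (auto simp: level_def)
qed

lemma rad_le_ecc: "x \<in> pverts G \<Longrightarrow> rad_ugraph G \<le> ecc_ugraph G x"
  unfolding rad_ugraph_def by (intro Min_le) auto

lemma obtain_centre:
  obtains x where "x \<in> pverts G" "ecc_ugraph G x = rad_ugraph G"
proof -
  have "rad_ugraph G \<in> ecc_ugraph G ` pverts G"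
    unfolding rad_ugraph_def using verts_nonempty by (intro Min_in) auto
  then show ?thesis using that by auto
qed

text \<open>A shortest path to \<open>p\<close> through \<open>v\<close> would have a proper prefix
  ending at \<open>v\<close>, making \<open>v\<close> strictly nearer to \<open>x\<close> than
  \<open>p\<close>.\<close>

lemma obtain_walk_avoiding:
  assumes "x \<in> pverts G" "p \<in> pverts G" "p \<noteq> v" "dist_ugraph G x p \<le> dist_ugraph G x v"
  obtains w where "awalk x w p" "v \<notin> set (awalk_verts x w)"
proof -
  obtain w where w: "apath x w p" "length w = dist_ugraph G x p"
    using shortest_path[OF assms(1,2)] .
  have walk: "awalk x w p" using w(1) by (rule awalkI_apath)
  moreover have "v \<notin> set (awalk_verts x w)"
  proof
    assume "v \<in> set (awalk_verts x w)"
    with walk obtain q r where qr: "w = q @ r" "awalk x q v" "awalk v r p"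
      by (metis awalk_decomp)
    then have "r \<noteq> []" using assms(3) by (auto simp: awalk_Nil_iff)
    then have "length q < length w" using qr(1) by simp
    with dist_le[OF qr(2)] w(2) assms(4) show False by simp
  qed
  ultimately show ?thesis using that by blast
qed

end

section \<open>Trees: lower bound on the levels\<close>

locale pair_tree = pair_connected_graph +
  assumes acyclic: "acyclic_ugraph G"
begin

text \<open>
  Walks from \<open>p\<close> and \<open>q\<close> to the root that avoid \<open>v\<close> would close up to a cycle through \<open>v\<close>. The
  hypothesis does not ask for \<open>p\<close> and \<open>q\<close> to be strictly closer to the root, so it also rules out
  edges inside a level.
\<close>

lemma nearer_nbr_unique:
  assumes x: "x \<in> pverts G"
    and p: "(v, p) \<in> parcs G" "dist_ugraph G x p \<le> dist_ugraph G x v"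
    and q: "(v, q) \<in> parcs G" "dist_ugraph G x q \<le> dist_ugraph G x v"
  shows "p = q"
proof (rule ccontr)
  assume ne: "p \<noteq> q"
  have verts: "p \<in> pverts G" "q \<in> pverts G" "p \<noteq> v" "q \<noteq> v" "v \<in> pverts G"
    using p q no_loops' by (auto dest: in_arcsD1 in_arcsD2)
  obtain w1 where w1: "awalk x w1 p" "v \<notin> set (awalk_verts x w1)"
    using obtain_walk_avoiding[OF x verts(1,3) p(2)] .
  obtain w2 where w2: "awalk x w2 q" "v \<notin> set (awalk_verts x w2)"
    using obtain_walk_avoiding[OF x verts(2,4) q(2)] .
  let ?w = "rev_path w1 @ w2"
  let ?a = "awalk_to_apath ?w"
  have w1': "awalk p (rev_path w1) x" "v \<notin> set (awalk_verts p (rev_path w1))"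
    using w1 by (auto simp: awalk_verts_rev_path)
  then have w: "awalk p ?w q" using w2 by (auto intro: awalk_appendI)
  have v_w: "v \<notin> set (awalk_verts p ?w)"
    using set_awalk_verts_append[OF w1'(1) w2(1)] w1' w2 by auto
  have a: "apath p ?a q" using w by (rule apath_awalk_to_apath)
  \<comment> \<open>The walk from \<open>p\<close> through \<open>x\<close> to \<open>q\<close> may
    repeat vertices. Its reduction to a path uses only its arcs and so still avoids
    \<open>v\<close>.\<close>
  have "set ?a \<subseteq> set ?w" using w by (rule awalk_to_apath_subset)
  then have "set (map fst ?a) \<subseteq> set (map fst ?w)" "set (map snd ?a) \<subseteq> set (map snd ?w)"
    unfolding set_map by (simp_all only: image_mono)
  then have "set (awalk_verts p ?a) \<subseteq> set (awalk_verts p ?w)"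
    unfolding set_awalk_verts[OF w] set_awalk_verts[OF awalkI_apath[OF a]]
    by (intro Un_mono order_refl)
  with v_w have v: "v \<notin> set (awalk_verts p ?a)" by blast
  let ?c = "(v, p) # ?a @ [(q, v)]"
  have walk: "awalk p (?a @ [(q, v)]) v"
    using a q(1) verts by (auto simp: apath_def awalk_simps arcs_symmetric)
  then have "awalk v ?c v" using p(1) verts by (auto simp: awalk_simps)
  moreover have "distinct (tl (awalk_verts v ?c))"
    using a v walk by (auto simp: apath_def awalk_verts_append)
  ultimately have "cycle ?c" unfolding cycle_def by blast
  \<comment> \<open>As \<open>p\<close> and \<open>q\<close> differ, the path between them has an
    arc; this rules out the degenerate cycle back and forth along one edge.\<close>
  moreover have "?a \<noteq> []" using a ne by (auto simp: apath_Nil_iff)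
  then have "3 \<le> length ?c" by (cases ?a) auto
  ultimately show False using acyclic unfolding acyclic_ugraph_def by blast
qed

text \<open>A neighbour that is not a child is no farther from the root than \<open>v\<close>, and
  by \<open>nearer_nbr_unique\<close> there is at most one such neighbour.\<close>

lemma card_children_ge:
  assumes "x \<in> pverts G" "v \<in> pverts G"
  shows "card (nbrs v) - 1 \<le> card (children x v)"
proof -
  define N where "N = {p \<in> nbrs v. dist_ugraph G x p \<le> dist_ugraph G x v}"
  have "finite N" by (simp add: N_def finite_nbrs)
  moreover have "\<forall>p\<in>N. \<forall>q\<in>N. p = q"
    using nearer_nbr_unique[OF assms(1)] by (auto simp: N_def nbrs_def)
  ultimately have "card N \<le> 1" by (simp add: card_le_Suc0_iff_eq)
  moreover have "children x v = nbrs v - N"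
    using dist_arc_le[OF assms(1)] by (auto simp: N_def children_def nbrs_def not_le le_antisym Suc_leI)
  moreover have "card (nbrs v) - card N \<le> card (nbrs v - N)"
    using \<open>finite N\<close> by (rule diff_card_le_card_Diff)
  ultimately show ?thesis by (metis diff_le_mono2 order_trans)
qed

text \<open>A common child of two vertices would have two distinct neighbours nearer the root, so
  the union in \<open>level_Suc\<close> is disjoint.\<close>

lemma card_level_Suc:
  assumes "x \<in> pverts G"
  shows "card (level x (Suc i)) = (\<Sum>v\<in>level x i. card (children x v))"
  unfolding level_Suc[OF assms]
proof (rule card_UN_disjoint)
  show "\<forall>u\<in>level x i. \<forall>v\<in>level x i. u \<noteq> v \<longrightarrow> children x u \<inter> children x v = {}"
  proof (intro ballI impI equals0I)
    fix u v w assume "u \<noteq> v" "w \<in> children x u \<inter> children x v"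
    then show False
      using nearer_nbr_unique[OF assms, of w u v] by (auto simp: children_def nbrs_def arcs_symmetric)
  qed
qed (auto simp: finite_level children_def finite_nbrs)

text \<open>Degrees are prescribed strictly below level \<open>m\<close> only: level
  \<open>m\<close> is counted through the children of the level before it.\<close>

lemma card_level_ge:
  assumes x: "x \<in> pverts G"
    and deg: "\<And>z. z \<in> pverts G \<Longrightarrow> dist_ugraph G x z < m \<Longrightarrow> degree_ugraph G z = k"
    and "i \<le> m"
  shows "level_bound k i \<le> card (level x i)"
  using \<open>i \<le> m\<close>
proof (induction i)
  case 0
  then show ?case using x by (simp add: level_0 level_bound_def)
next
  case (Suc i)
  have k: "card (nbrs v) = k" if "v \<in> level x i" for v
    using that deg[of v] Suc.prems by (auto simp: level_def degree_eq_card_nbrs)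
  show ?case
  proof (cases i)
    case 0
    then show ?thesis
      using x k[of x] by (simp add: level_Suc level_0 children_root level_bound_def)
  next
    case (Suc j)
    have "level_bound k (Suc i) = level_bound k i * (k - 1)"
      using Suc by (simp add: level_bound_def)
    also have "\<dots> \<le> card (level x i) * (k - 1)" using Suc.IH Suc.prems by simp
    also have "\<dots> = (\<Sum>v\<in>level x i. k - 1)" by simp
    also have "\<dots> \<le> (\<Sum>v\<in>level x i. card (children x v))"
      using card_children_ge[OF x] k by (intro sum_mono) (force simp: level_def)
    also have "\<dots> = card (level x (Suc i))" using card_level_Suc[OF x] by simp
    finally show ?thesis .
  qed
qed

end

section \<open>Comparison of the two trees\<close>

lemma pair_tree_iff: "pair_tree G \<longleftrightarrow> tree_ugraph G"
  by (auto simp: tree_ugraph_def pair_tree_def pair_tree_axioms_def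
      pair_connected_graph_def pair_connected_graph_axioms_def)

theorem theorem1:
  fixes T :: "'a pair_pre_digraph" and B :: "'b pair_pre_digraph" and n k :: nat
  assumes "tree_ugraph T" and "card (pverts T) = n" and "max_degree_ugraph T = k"
    and "balanced_tree k B" and "card (pverts B) = n"
  shows "rad_ugraph B \<le> rad_ugraph T"
proof -
  interpret T: pair_tree T using assms(1) by (simp add: pair_tree_iff)
  interpret B: pair_tree B using assms(4) by (simp add: pair_tree_iff balanced_tree_def)
  obtain c where c: "c \<in> pverts T" "ecc_ugraph T c = rad_ugraph T"
    using T.obtain_centre .
  obtain x where x: "x \<in> pverts B"
    and deg: "\<And>z. z \<in> pverts B \<Longrightarrow> dist_ugraph B z x + 2 \<le> ecc_ugraph B x \<Longrightarrow> degree_ugraph B z = k"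
    using assms(4) by (auto simp: balanced_tree_def)
  let ?e = "ecc_ugraph B x" and ?r = "rad_ugraph T"
  have "?e \<le> ?r"
  proof (rule ccontr)
    assume "\<not> ?e \<le> ?r"
    \<comment> \<open>With eccentricity \<open>Suc m\<close>, the balance condition
      \<open>dist + 2 \<le> Suc m\<close> says \<open>dist < m\<close>, which is the degree
      hypothesis of \<open>card_level_ge\<close>.\<close>
    then obtain m where m: "?e = Suc m" "?r \<le> m" by (cases ?e) auto
    have "n \<le> (\<Sum>i\<le>?r. level_bound k i)"
      using T.card_verts_eq_sum_level[of c] T.card_level_le[OF c(1)] assms(2,3) c(2)
      by (simp add: sum_mono)
    also have "\<dots> \<le> (\<Sum>i\<le>m. level_bound k i)"
      using m(2) by (intro sum_mono2) auto
    \<comment> \<open>\<open>balanced_tree\<close> measures distance towards \<open>x\<close>,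
      levels measure it from \<open>x\<close>; hence \<open>dist_commute\<close>.\<close>
    also have "\<dots> \<le> (\<Sum>i\<le>m. card (B.level x i))"
      using B.card_level_ge[OF x, of m k] deg B.dist_commute[OF x] m(1)
      by (intro sum_mono) auto
    \<comment> \<open>The last level may be incomplete, but one vertex in it makes the inequality
      strict.\<close>
    also have "\<dots> < (\<Sum>i\<le>?e. card (B.level x i))"
      using B.level_ecc_nonempty[of x] B.finite_level m(1) by (simp add: card_gt_0_iff)
    also have "\<dots> = n" using B.card_verts_eq_sum_level[of x] assms(5) by simp
    finally show False by simp
  qed
  with B.rad_le_ecc[OF x] show ?thesis by linarith
qed

end
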